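(* Let $A,B\in\mathbb{C}^{m\times n}$ with $\operatorname{rank}(A)=r\ge 1$ and $\operatorname{rank}(B)=s\ge 1$, and let $E=B-A$ and $\widetilde{E}=B^{\dagger}-A^{\dagger}$. Define \[ \alpha_{1}:=\max\bigg\{\frac{\|B^{\dagger}EA^{\dagger}\|_{F}^{2}}{\|B^{\dagger}\|_{2}^{2}},\frac{\|B\widetilde{E}A\|_{F}^{2}}{\|A\|_{2}^{2}}\bigg\},\qquad \alpha_{2}:=\max\bigg\{\frac{\|A^{\dagger}EB^{\dagger}\|_{F}^{2}}{\|A^{\dagger}\|_{2}^{2}},\frac{\|A\widetilde{E}B\|_{F}^{2}}{\|B\|_{2}^{2}}\bigg\}. \] Then \[ \|P_{B}-P_{A}\|_{F}^{2}\leq\|EA^{\dagger}\|_{F}^{2}+\|EB^{\dagger}\|_{F}^{2}-\alpha_{1}-\alpha_{2}. \] In particular, if $s=r$, then \[ \|P_{B}-P_{A}\|_{F}^{2}\leq 2\min\big\{\|EA^{\dagger}\|_{F}^{2}-\alpha_{1},\ \|EB^{\dagger}\|_{F}^{2}-\alpha_{2}\big\}. \]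
   Context: For a complex matrix $M$: $M^{\dagger}$ is the Moore--Penrose inverse, $\|M\|_{F}$ the Frobenius norm, $\|M\|_{2}$ the spectral norm, and $P_{M}=MM^{\dagger}$ the orthogonal projection onto the column space of $M$. *)

theory Defs
  imports "HOL-Analysis.Analysis"
begin

text \<open>
  A complex \<open>m \<times> n\<close> matrix is an element of \<open>complex ^ 'n ^ 'm\<close>, where
  \<open>CARD('m) = m\<close> and \<open>CARD('n) = n\<close>.
\<close>

definition conj_transpose :: "complex ^ 'n ^ 'm \<Rightarrow> complex ^ 'm ^ 'n" where
  "conj_transpose M = map_matrix cnj (transpose M)"

text \<open>The four Penrose equations.\<close>

definition is_moore_penrose_inverse ::
    "complex ^ 'n ^ 'm \<Rightarrow> complex ^ 'm ^ 'n \<Rightarrow> bool" where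
  "is_moore_penrose_inverse M X \<longleftrightarrow>
     M ** X ** M = M \<and>
     X ** M ** X = X \<and>
     conj_transpose (M ** X) = M ** X \<and>
     conj_transpose (X ** M) = X ** M"

definition moore_penrose_inverse ::
    "complex ^ 'n ^ 'm \<Rightarrow> complex ^ 'm ^ 'n"  (\<open>(_\<^sup>\<dagger>)\<close> [1000] 1000) where
  "M\<^sup>\<dagger> = (THE X. is_moore_penrose_inverse M X)"

definition frobenius_norm :: "complex ^ 'n ^ 'm \<Rightarrow> real" where
  "frobenius_norm M = sqrt (\<Sum>i\<in>UNIV. \<Sum>j\<in>UNIV. (cmod (M $ i $ j))\<^sup>2)"

lemma frobenius_norm_eq_norm: "frobenius_norm M = norm M"
  by (simp add: frobenius_norm_def norm_vec_def L2_set_def sum_nonneg)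

text \<open>
  The norm on \<open>complex ^ 'n\<close> is the Euclidean one, so the operator norm induced by it
  is the spectral norm.
\<close>

definition spectral_norm :: "complex ^ 'n ^ 'm \<Rightarrow> real" where
  "spectral_norm M = onorm ((*v) M)"

definition col_proj :: "complex ^ 'n ^ 'm \<Rightarrow> complex ^ 'm ^ 'm" where
  "col_proj M = M ** M\<^sup>\<dagger>"

end

theory Submission
  imports Defs
begin

text \<open>
  Put \<open>P = P\<^sub>A\<close> and \<open>Q = P\<^sub>B\<close>. The columns of \<open>Q - P = (Q - Q P) - (P - Q P)\<close> split orthogonally along
  the range of \<open>Q\<close>, so \<open>\<parallel>Q - P\<parallel>\<^sup>2 = \<parallel>Q - P Q\<parallel>\<^sup>2 + \<parallel>P - Q P\<parallel>\<^sup>2\<close>. In the same way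
  \<open>\<parallel>E A\<^sup>\<dagger>\<parallel>\<^sup>2 = \<parallel>Q E A\<^sup>\<dagger>\<parallel>\<^sup>2 + \<parallel>P - Q P\<parallel>\<^sup>2\<close>, and \<open>\<alpha>\<^sub>1 \<le> \<parallel>Q E A\<^sup>\<dagger>\<parallel>\<^sup>2\<close> because
  \<open>B\<^sup>\<dagger> E A\<^sup>\<dagger> = B\<^sup>\<dagger> (Q E A\<^sup>\<dagger>)\<close> and \<open>B E' A = - (Q E A\<^sup>\<dagger>) A\<close>. If the ranks agree, then
  \<open>P\<close> and \<open>Q\<close> have the same trace, hence \<open>\<parallel>P - Q P\<parallel> = \<parallel>Q - P Q\<parallel>\<close>.
\<close>

section \<open>Conjugate transpose, trace and Frobenius norm\<close>

lemma matrix_diff_ldistrib: "A ** (B - C) = A ** B - A ** (C :: 'a::ring_1 ^ _ ^ _)"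
  by (vector matrix_matrix_mult_def sum_subtractf[symmetric] algebra_simps)

lemma matrix_diff_rdistrib: "(A - B) ** C = A ** C - B ** (C :: 'a::ring_1 ^ _ ^ _)"
  by (vector matrix_matrix_mult_def sum_subtractf[symmetric] algebra_simps)

lemma conj_transpose_nth [simp]: "conj_transpose M $ i $ j = cnj (M $ j $ i)"
  by (simp add: conj_transpose_def transpose_def)

lemma conj_transpose_conj_transpose [simp]: "conj_transpose (conj_transpose M) = M"
  by (simp add: vec_eq_iff)

lemma conj_transpose_diff: "conj_transpose (M - N) = conj_transpose M - conj_transpose N"
  by (simp add: vec_eq_iff)

lemma conj_transpose_mult: "conj_transpose (M ** N) = conj_transpose N ** conj_transpose M"
  by (simp add: vec_eq_iff matrix_matrix_mult_def mult.commute)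

text \<open>Reduces identities between squared norms to identities between matrices, through
  linearity and cyclicity of the trace.\<close>

lemma trace_conj_transpose_mult_self:
  "trace (conj_transpose M ** M) = of_real ((norm M)\<^sup>2)"
proof -
  have "(norm M)\<^sup>2 = (\<Sum>i\<in>UNIV. \<Sum>j\<in>UNIV. (cmod (M $ i $ j))\<^sup>2)"
    by (simp add: frobenius_norm_eq_norm[symmetric] frobenius_norm_def sum_nonneg)
  also have "complex_of_real \<dots> = (\<Sum>j\<in>UNIV. \<Sum>i\<in>UNIV. cnj (M $ i $ j) * M $ i $ j)"
    by (subst sum.swap) (simp only: of_real_sum complex_norm_square mult.commute)
  finally show ?thesis
    by (simp add: trace_def matrix_matrix_mult_def)
qed

lemma norm_conj_transpose [simp]: "norm (conj_transpose M) = norm M"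
proof -
  have "complex_of_real ((norm (conj_transpose M))\<^sup>2) = of_real ((norm M)\<^sup>2)"
    using trace_conj_transpose_mult_self[of "conj_transpose M"] trace_conj_transpose_mult_self[of M]
    by (simp add: trace_mul_sym[of M])
  then show ?thesis
    by (simp only: of_real_eq_iff power2_eq_iff_nonneg norm_ge_zero)
qed

lemma conj_transpose_mult_self_eq_0_iff: "conj_transpose M ** M = 0 \<longleftrightarrow> M = 0"
proof
  assume "conj_transpose M ** M = 0"
  then have "complex_of_real ((norm M)\<^sup>2) = 0"
    by (simp only: trace_conj_transpose_mult_self[symmetric]) (simp add: trace_def)
  then show "M = 0"
    by simp
qed (simp add: vec_eq_iff matrix_matrix_mult_def)

text \<open>The Gram matrix of \<open>M ** (X - Y)\<close> vanishes, so the matrix itself does. This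
  passes from an inner inverse of the Gram matrix of \<open>M\<close> to one of
  \<open>M\<close>.\<close>

lemma conj_transpose_mult_left_cancel:
  assumes "conj_transpose M ** M ** X = conj_transpose M ** M ** Y"
  shows "M ** X = M ** Y"
proof -
  have "conj_transpose (M ** (X - Y)) ** (M ** (X - Y)) =
        conj_transpose (X - Y) ** (conj_transpose M ** M ** (X - Y))"
    by (simp only: conj_transpose_mult matrix_mul_assoc)
  also have "conj_transpose M ** M ** (X - Y) = 0"
    using assms by (simp add: matrix_diff_ldistrib)
  also have "conj_transpose (X - Y) ** 0 = 0"
    by (simp add: vec_eq_iff matrix_matrix_mult_def)
  finally have "M ** (X - Y) = 0"
    by (simp add: conj_transpose_mult_self_eq_0_iff)
  then show ?thesis
    by (simp add: matrix_diff_ldistrib)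
qed

text \<open>Pythagoras: for a Hermitian idempotent \<open>P\<close> the cross terms cancel already
  in the Gram matrices, and taking traces gives the norms.\<close>

lemma norm_orthogonal_projection:
  assumes "conj_transpose P = P" and "P ** P = P"
  shows "(norm M)\<^sup>2 = (norm (P ** M))\<^sup>2 + (norm (M - P ** M))\<^sup>2"
proof -
  \<comment> \<open>Once products are associated to the left, \<open>P ** P\<close> is no longer a
    subterm, so idempotence is needed behind a prefix.\<close>
  have "conj_transpose M ** (P ** P) = conj_transpose M ** P"
    by (simp only: assms(2))
  then have PP: "conj_transpose M ** P ** P = conj_transpose M ** P"
    by (simp only: matrix_mul_assoc)
  have "conj_transpose M ** M = conj_transpose (P ** M) ** (P ** M)
          + conj_transpose (M - P ** M) ** (M - P ** M)"
    by (simp add: conj_transpose_mult conj_transpose_diff matrix_diff_ldistrib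
        matrix_diff_rdistrib matrix_mul_assoc assms PP)
  then have "complex_of_real ((norm M)\<^sup>2) = of_real ((norm (P ** M))\<^sup>2 + (norm (M - P ** M))\<^sup>2)"
    by (simp only: trace_conj_transpose_mult_self[symmetric] of_real_add trace_add)
  then show ?thesis
    by (simp only: of_real_eq_iff)
qed

section \<open>Spectral norm bounds for Frobenius norms of products\<close>

lemma spectral_norm_nonneg: "0 \<le> spectral_norm M"
  unfolding spectral_norm_def by (rule onorm_pos_le[OF matrix_vector_mul_bounded_linear])

lemma norm_matrix_vector_le: "norm (M *v x) \<le> spectral_norm M * norm x"
  unfolding spectral_norm_def by (rule onorm[OF matrix_vector_mul_bounded_linear])

lemma inner_conj_transpose_vector:
  "inner (conj_transpose M *v x) y = inner x (M *v y)"
proof -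
  have "inner (conj_transpose M *v x) y =
        (\<Sum>j\<in>UNIV. \<Sum>i\<in>UNIV. inner (cnj (M $ i $ j) * x $ i) (y $ j))"
    by (simp add: inner_vec_def matrix_vector_mult_def inner_sum_left)
  also have "\<dots> = (\<Sum>j\<in>UNIV. \<Sum>i\<in>UNIV. inner (x $ i) (M $ i $ j * y $ j))"
    by (simp add: inner_complex_def algebra_simps)
  also have "\<dots> = inner x (M *v y)"
    by (subst sum.swap) (simp add: inner_vec_def matrix_vector_mult_def inner_sum_right)
  finally show ?thesis .
qed

text \<open>With y the image of x under the adjoint, |y|^2 is the inner product of x and My, so
  Cauchy-Schwarz bounds it by |x| |My|; then one factor |y| is cancelled.\<close>

lemma spectral_norm_conj_transpose_le: "spectral_norm (conj_transpose M) \<le> spectral_norm M"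
proof -
  have "norm (conj_transpose M *v x) \<le> spectral_norm M * norm x" for x
  proof -
    let ?y = "conj_transpose M *v x"
    have "norm ?y * norm ?y = inner x (M *v ?y)"
      by (simp only: inner_conj_transpose_vector[of M x ?y, symmetric]
          power2_norm_eq_inner[symmetric] power2_eq_square)
    also have "\<dots> \<le> norm x * norm (M *v ?y)"
      by (rule norm_cauchy_schwarz)
    also have "\<dots> \<le> norm x * (spectral_norm M * norm ?y)"
      by (intro mult_left_mono norm_matrix_vector_le norm_ge_zero)
    finally have "norm ?y * norm ?y \<le> (spectral_norm M * norm x) * norm ?y"
      by (simp add: mult_ac)
    then show ?thesis
      by (cases "?y = 0") (auto simp: spectral_norm_nonneg)
  qed
  then show ?thesis
    unfolding spectral_norm_def[of "conj_transpose M"] by (rule onorm_le)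
qed

lemma norm_matrix_columns: "(norm (M :: complex ^ 'n ^ 'm))\<^sup>2 = (\<Sum>j\<in>UNIV. (norm (column j M))\<^sup>2)"
  unfolding frobenius_norm_eq_norm[symmetric] frobenius_norm_def
  by (subst sum.swap) (simp add: sum_nonneg norm_vec_def L2_set_def column_def)

text \<open>Columnwise: \<open>M\<close> acts on each column of \<open>N\<close> separately, and
  squared Frobenius norms add over columns.\<close>

lemma norm_matrix_mult_le_left: "norm (M ** N) \<le> spectral_norm M * norm N"
proof (rule power2_le_imp_le)
  have "column j (M ** N) = M *v column j N" for j
    by (simp add: vec_eq_iff column_def matrix_matrix_mult_def matrix_vector_mult_def)
  then have "(norm (M ** N))\<^sup>2 \<le> (\<Sum>j\<in>UNIV. (spectral_norm M * norm (column j N))\<^sup>2)"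
    unfolding norm_matrix_columns[of "M ** N"]
    by (intro sum_mono power_mono) (auto simp: norm_matrix_vector_le)
  then show "(norm (M ** N))\<^sup>2 \<le> (spectral_norm M * norm N)\<^sup>2"
    by (simp add: power_mult_distrib norm_matrix_columns[of N] sum_distrib_left)
qed (simp add: spectral_norm_nonneg)

lemma norm_matrix_mult_le_right: "norm (M ** N) \<le> spectral_norm N * norm M"
proof -
  have "norm (M ** N) = norm (conj_transpose N ** conj_transpose M)"
    by (simp add: conj_transpose_mult[symmetric])
  also have "\<dots> \<le> spectral_norm (conj_transpose N) * norm (conj_transpose M)"
    by (rule norm_matrix_mult_le_left)
  also have "\<dots> \<le> spectral_norm N * norm M"
    by (simp add: mult_right_mono spectral_norm_conj_transpose_le)
  finally show ?thesis .
qed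

section \<open>Existence and uniqueness of the Moore-Penrose inverse\<close>

text \<open>\<open>X\<close> is the matrix of a linear right inverse of \<open>N\<close> on its
  range.\<close>

lemma matrix_inner_inverse_exists:
  fixes N :: "'a::field ^ 'n ^ 'm"
  obtains X where "N ** X ** N = N"
proof -
  obtain g where g: "Vector_Spaces.linear (*s) (*s) g" "\<forall>v\<in>range ((*v) N). N *v g v = v"
    using vec.linear_exists_right_inverse_on[OF matrix_vector_mul_linear_gen[of N] vec.subspace_UNIV]
    by blast
  have "N ** matrix g ** N = N"
    unfolding matrix_eq using g
    by (simp add: matrix_vector_mul_assoc[symmetric] matrix_works[OF g(1)])
  then show thesis ..
qed

text \<open>The matrix is \<open>(M\<^sup>* M)\<^sup>- M\<^sup>*\<close> for any inner inverse \<open>(M\<^sup>* M)\<^sup>-\<close> of \<open>M\<^sup>* M\<close>.\<close>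

lemma matrix_hermitian_inner_inverse_exists:
  obtains G where "M ** G ** M = M" and "conj_transpose (M ** G) = M ** G"
proof -
  let ?H = "conj_transpose M"
  obtain X where "?H ** M ** X ** (?H ** M) = ?H ** M"
    using matrix_inner_inverse_exists .
  then have "?H ** M ** (X ** ?H ** M) = ?H ** M ** mat 1"
    by (simp add: matrix_mul_assoc)
  then have "M ** (X ** ?H ** M) = M ** mat 1"
    by (rule conj_transpose_mult_left_cancel)
  then have 1: "M ** X ** ?H ** M = M"
    by (simp add: matrix_mul_assoc)
  \<comment> \<open>The adjoint of 1, inserted for the last factor of \<open>M ** X ** ?H\<close>,
    lets 1 replace \<open>X\<close> by its adjoint; hence that product is Hermitian.\<close>
  from arg_cong[OF this, of conj_transpose]
  have 2: "?H ** M ** conj_transpose X ** ?H = ?H"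
    by (simp add: conj_transpose_mult matrix_mul_assoc)
  have "M ** X ** ?H = M ** X ** (?H ** M ** conj_transpose X ** ?H)"
    by (simp only: 2)
  also have "\<dots> = M ** conj_transpose X ** ?H"
    by (simp add: matrix_mul_assoc 1)
  finally have "conj_transpose (M ** (X ** ?H)) = M ** (X ** ?H)"
    by (simp add: conj_transpose_mult matrix_mul_assoc)
  with 1 show thesis
    by (intro that[of "X ** ?H"]) (simp_all add: matrix_mul_assoc)
qed

text \<open>With inner inverses \<open>G\<close> and \<open>H\<close> such that
  \<open>M ** G\<close> and \<open>H ** M\<close> are Hermitian, the product
  \<open>H ** M ** G\<close> inherits both symmetries.\<close>

lemma moore_penrose_inverse_exists: "\<exists>X. is_moore_penrose_inverse M X"
proof -
  obtain G where G: "M ** G ** M = M" "conj_transpose (M ** G) = M ** G"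
    using matrix_hermitian_inner_inverse_exists .
  \<comment> \<open>The same construction for the adjoint of \<open>M\<close>; the adjoint of
    \<open>K\<close> is then an inner inverse of \<open>M\<close> with the Hermitian product on the
    other side.\<close>
  obtain K where K: "conj_transpose M ** K ** conj_transpose M = conj_transpose M"
      "conj_transpose (conj_transpose M ** K) = conj_transpose M ** K"
    using matrix_hermitian_inner_inverse_exists .
  define H where "H = conj_transpose K"
  have HM: "conj_transpose (H ** M) = H ** M"
    using K(2) by (simp add: H_def conj_transpose_mult)
  have MHM: "M ** H ** M = M"
    using arg_cong[OF K(1), of conj_transpose] by (simp add: H_def conj_transpose_mult matrix_mul_assoc)
  have L: "M ** (H ** M ** G) = M ** G"
    by (simp add: matrix_mul_assoc MHM)
  have "H ** (M ** G ** M) = H ** M"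
    by (simp only: G(1))
  then have R: "H ** M ** G ** M = H ** M"
    by (simp only: matrix_mul_assoc)
  have "H ** M ** G ** M ** (H ** M ** G) = H ** (M ** H ** M) ** G"
    by (simp only: R matrix_mul_assoc)
  also have "\<dots> = H ** M ** G"
    by (simp only: MHM)
  finally have "H ** M ** G ** M ** (H ** M ** G) = H ** M ** G" .
  then have "is_moore_penrose_inverse M (H ** M ** G)"
    unfolding is_moore_penrose_inverse_def L R using G HM by simp
  then show ?thesis ..
qed

text \<open>Taking adjoints reverses a product of two Hermitian projections, which shows that both
  inverses induce the same \<open>M ** X\<close> and the same \<open>X ** M\<close>. These two
  products determine \<open>X\<close>, since \<open>X = X ** M ** X\<close>.\<close>

lemma moore_penrose_inverse_unique:
  assumes "is_moore_penrose_inverse M X" and "is_moore_penrose_inverse M Y"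
  shows "X = Y"
proof -
  note X = assms(1)[unfolded is_moore_penrose_inverse_def]
  note Y = assms(2)[unfolded is_moore_penrose_inverse_def]
  have "M ** X = conj_transpose (M ** Y ** M ** X)"
    using X Y by simp
  also have "\<dots> = conj_transpose (M ** X) ** conj_transpose (M ** Y)"
    by (simp add: conj_transpose_mult matrix_mul_assoc)
  also have "\<dots> = M ** Y"
    using X Y by (simp add: matrix_mul_assoc)
  finally have L: "M ** X = M ** Y" .
  have "X ** M = conj_transpose (X ** (M ** Y ** M))"
    using X Y by simp
  also have "\<dots> = conj_transpose (Y ** M) ** conj_transpose (X ** M)"
    by (simp add: conj_transpose_mult matrix_mul_assoc)
  also have "\<dots> = Y ** M ** (X ** M)"
    using X Y by simp
  also have "\<dots> = Y ** (M ** X ** M)"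
    by (simp only: matrix_mul_assoc)
  also have "\<dots> = Y ** M"
    using X by simp
  finally have R: "X ** M = Y ** M" .
  have "X = X ** (M ** X)"
    using X by (simp add: matrix_mul_assoc)
  also have "\<dots> = X ** M ** Y"
    by (simp only: L matrix_mul_assoc)
  also have "\<dots> = Y"
    using Y by (simp add: R)
  finally show ?thesis .
qed

lemma is_moore_penrose_inverse_moore_penrose_inverse: "is_moore_penrose_inverse M (M\<^sup>\<dagger>)"
  unfolding moore_penrose_inverse_def
  using moore_penrose_inverse_exists moore_penrose_inverse_unique by (metis (no_types) theI)

lemma
  shows mult_moore_penrose_mult: "M ** M\<^sup>\<dagger> ** M = M"
    and moore_penrose_mult_moore_penrose: "M\<^sup>\<dagger> ** M ** M\<^sup>\<dagger> = M\<^sup>\<dagger>"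
    and conj_transpose_col_proj: "conj_transpose (col_proj M) = col_proj M"
  using is_moore_penrose_inverse_moore_penrose_inverse[of M]
  unfolding is_moore_penrose_inverse_def col_proj_def by auto

lemma col_proj_idem: "col_proj M ** col_proj M = col_proj M"
  by (simp add: col_proj_def matrix_mul_assoc mult_moore_penrose_mult)

lemma col_proj_mult_self: "col_proj M ** M = M"
  by (simp add: col_proj_def mult_moore_penrose_mult)

lemma moore_penrose_mult_col_proj: "M\<^sup>\<dagger> ** col_proj M = M\<^sup>\<dagger>"
  by (simp add: col_proj_def matrix_mul_assoc moore_penrose_mult_moore_penrose)

section \<open>Rank and trace of projections\<close>

text \<open>
  An isomorphism \<open>f\<close> of the ranges with inverse \<open>g\<close> gives \<open>Q = (f P) (g Q)\<close> and \<open>P = (g Q) (f P)\<close>.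
\<close>

lemma trace_idempotent_eq_if_dim_range_eq:
  fixes P Q :: "'a::field ^ 'n ^ 'n"
  assumes P: "P ** P = P" and Q: "Q ** Q = Q"
    and dim: "vec.dim (range ((*v) P)) = vec.dim (range ((*v) Q))"
  shows "trace P = trace Q"
proof -
  have sub: "vec.subspace (range ((*v) M))" for M :: "'a ^ 'n ^ 'n"
    by (rule vec.subspace_image[OF vec.subspace_UNIV])
  obtain f where f: "Vector_Spaces.linear (*s) (*s) f"
      "f ` range ((*v) P) = range ((*v) Q)" "inj_on f (range ((*v) P))"
    using vec.subspace_isomorphism[OF sub sub dim] by blast
  obtain g where g: "Vector_Spaces.linear (*s) (*s) g" "\<forall>v\<in>range ((*v) P). g (f v) = v"
    using vec.linear_exists_left_inverse_on[OF f(1) sub f(3)] by blast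
  have Pfix: "P *v v = v" if "v \<in> range ((*v) P)" for v
    using that by (metis P imageE matrix_vector_mul_assoc)
  have Qfix: "Q *v v = v" if "v \<in> range ((*v) Q)" for v
    using that by (metis Q imageE matrix_vector_mul_assoc)
  define F where "F = matrix f ** P"
  define G where "G = matrix g ** Q"
  have F: "F *v x = f (P *v x)" and G: "G *v x = g (Q *v x)" for x
    by (simp_all add: F_def G_def matrix_vector_mul_assoc[symmetric]
        matrix_works[OF f(1)] matrix_works[OF g(1)])
  have "G *v (F *v x) = P *v x" for x
  proof -
    have "f (P *v x) \<in> range ((*v) Q)"
      using f(2) by blast
    then have "G *v (F *v x) = g (f (P *v x))"
      by (simp only: F G Qfix)
    also have "\<dots> = P *v x"
      using g(2) by blast
    finally show ?thesis .
  qed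
  then have GF: "G ** F = P"
    by (simp add: matrix_eq matrix_vector_mul_assoc[symmetric])
  have "F *v (G *v x) = Q *v x" for x
  proof -
    have "Q *v x \<in> f ` range ((*v) P)"
      using f(2) by blast
    then obtain v where v: "v \<in> range ((*v) P)" "Q *v x = f v"
      by blast
    have "F *v (G *v x) = f (P *v g (f v))"
      by (simp only: F G v(2))
    also have "\<dots> = f v"
      by (simp only: bspec[OF g(2) v(1)] Pfix[OF v(1)])
    finally show ?thesis
      by (simp only: v(2))
  qed
  then have FG: "F ** G = Q"
    by (simp add: matrix_eq matrix_vector_mul_assoc[symmetric])
  show ?thesis
    using trace_mul_sym[of F G] by (simp add: GF FG)
qed

text \<open>The transpose sends the standard basis to the rows of \<open>A\<close>, so its range is
  the row space.\<close>

lemma rank_eq_dim_range_transpose: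
  fixes A :: "'a::field ^ 'n ^ 'm"
  shows "rank A = vec.dim (range ((*v) (transpose A)))"
proof -
  have 1: "transpose A *v axis i 1 = row i A" for i
    by (simp add: row_def vec_eq_iff matrix_vector_mult_def transpose_def axis_def if_distrib
        cong: if_cong)
  have 2: "rows A = range (\<lambda>i. row i A)"
    by (auto simp: rows_def)
  have 3: "cart_basis = range (\<lambda>i :: 'm. axis i (1 :: 'a))"
    by (auto simp: cart_basis_def)
  have "rows A = (*v) (transpose A) ` cart_basis"
    unfolding 2 3 image_image 1 ..
  then have "vec.span (rows A) = range ((*v) (transpose A))"
    by (simp only: vec.span_image span_cart_basis)
  then show ?thesis
    unfolding row_rank_def_gen by (metis vec.dim_span)
qed

text \<open>
  \<^const>\<open>rank\<close> is the row rank, hence the detour over the transpose of \<open>M\<^sup>\<dagger> M\<close>,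
  which has the same row space as \<open>M\<close> and the same trace as \<open>M M\<^sup>\<dagger>\<close>.
\<close>

lemma trace_col_proj_eq_if_rank_eq:
  fixes A B :: "complex ^ 'n ^ 'm"
  assumes "rank A = rank B"
  shows "trace (col_proj A) = trace (col_proj B)"
proof -
  define R where "R M = transpose (M\<^sup>\<dagger> ** M)" for M :: "complex ^ 'n ^ 'm"
  have idem: "R M ** R M = R M" for M
    by (simp add: R_def matrix_transpose_mul[symmetric] matrix_mul_assoc
        moore_penrose_mult_moore_penrose)
  have "transpose M = R M ** transpose M" for M :: "complex ^ 'n ^ 'm"
    by (simp add: R_def matrix_transpose_mul[symmetric] matrix_mul_assoc mult_moore_penrose_mult)
  then have "transpose M *v x = R M *v (transpose M *v x)" for M :: "complex ^ 'n ^ 'm" and x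
    by (simp only: matrix_vector_mul_assoc)
  then have 1: "range ((*v) (transpose M)) \<subseteq> range ((*v) (R M))" for M
    by blast
  have "R M *v x = transpose M *v (transpose (M\<^sup>\<dagger>) *v x)" for M x
    by (simp only: R_def matrix_transpose_mul matrix_vector_mul_assoc)
  then have 2: "range ((*v) (R M)) \<subseteq> range ((*v) (transpose M))" for M
    by blast
  have "rank M = vec.dim (range ((*v) (R M)))" for M
    unfolding rank_eq_dim_range_transpose subset_antisym[OF 1 2] ..
  then have "trace (R A) = trace (R B)"
    using assms by (intro trace_idempotent_eq_if_dim_range_eq idem) metis
  moreover have "trace (R M) = trace (col_proj M)" for M
    unfolding col_proj_def trace_mul_sym[of M] R_def by (simp add: trace_def transpose_def)
  ultimately show ?thesis
    by simp
qed

section \<open>Residuals of one column projection against the other\<close>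

lemma norm_col_proj_diff:
  fixes A :: "complex ^ 'n ^ 'm" and B :: "complex ^ 'k ^ 'm"
  shows "(norm (col_proj B - col_proj A))\<^sup>2 =
         (norm (col_proj A - col_proj B ** col_proj A))\<^sup>2 +
         (norm (col_proj B - col_proj A ** col_proj B))\<^sup>2"
proof -
  let ?P = "col_proj A" and ?Q = "col_proj B"
  have "(norm (?Q - ?P))\<^sup>2 = (norm (?Q - ?Q ** ?P))\<^sup>2 + (norm (?Q ** ?P - ?P))\<^sup>2"
    using norm_orthogonal_projection[OF conj_transpose_col_proj col_proj_idem, of "?Q - ?P" B]
    by (simp add: matrix_diff_ldistrib col_proj_idem)
  \<comment> \<open>The two sides are adjoints of each other, as both projections are
    Hermitian.\<close>
  moreover have "norm (?Q - ?Q ** ?P) = norm (?Q - ?P ** ?Q)"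
    using norm_conj_transpose[of "?Q - ?Q ** ?P"]
    by (simp add: conj_transpose_diff conj_transpose_mult conj_transpose_col_proj)
  ultimately show ?thesis
    by (simp add: norm_minus_commute)
qed

text \<open>Pythagoras for \<open>col_proj A\<close>, whose squared norm is its trace. The
  subtracted term is symmetric in the two projections, so only the traces can distinguish the two
  residuals.\<close>

lemma norm_col_proj_residual:
  fixes A :: "complex ^ 'n ^ 'm" and B :: "complex ^ 'k ^ 'm"
  shows "complex_of_real ((norm (col_proj A - col_proj B ** col_proj A))\<^sup>2) =
         trace (col_proj A) - of_real ((norm (col_proj B ** col_proj A))\<^sup>2)"
  using norm_orthogonal_projection[OF conj_transpose_col_proj col_proj_idem, of "col_proj A" B]
    trace_conj_transpose_mult_self[of "col_proj A"]
  by (simp add: conj_transpose_col_proj col_proj_idem)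

lemma norm_col_proj_residual_commute:
  fixes A B :: "complex ^ 'n ^ 'm"
  assumes "rank A = rank B"
  shows "norm (col_proj A - col_proj B ** col_proj A) =
         norm (col_proj B - col_proj A ** col_proj B)"
proof -
  have "norm (col_proj B ** col_proj A) = norm (col_proj A ** col_proj B)"
    using norm_conj_transpose[of "col_proj B ** col_proj A"]
    by (simp add: conj_transpose_mult conj_transpose_col_proj)
  then have "complex_of_real ((norm (col_proj A - col_proj B ** col_proj A))\<^sup>2) =
             of_real ((norm (col_proj B - col_proj A ** col_proj B))\<^sup>2)"
    unfolding norm_col_proj_residual by (simp add: trace_col_proj_eq_if_rank_eq[OF assms])
  then show ?thesis
    by (simp only: of_real_eq_iff power2_eq_iff_nonneg norm_ge_zero)
qed

text \<open>The case \<open>c = 0\<close> is covered by \<open>x / 0 = 0\<close>.\<close>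

lemma power2_divide_le_if_le_mult:
  fixes a c d :: real
  assumes "0 \<le> a" and "a \<le> c * d"
  shows "a\<^sup>2 / c\<^sup>2 \<le> d\<^sup>2"
proof (cases "c = 0")
  case False
  have "a\<^sup>2 \<le> (c * d)\<^sup>2"
    using assms by (intro power_mono)
  with False show ?thesis
    by (simp add: power_mult_distrib field_simps)
qed simp

lemma norm_col_proj_residual_le:
  fixes A B :: "complex ^ 'n ^ 'm"
  shows "(norm (col_proj A - col_proj B ** col_proj A))\<^sup>2 \<le> (norm ((B - A) ** A\<^sup>\<dagger>))\<^sup>2 -
    max ((norm (B\<^sup>\<dagger> ** (B - A) ** A\<^sup>\<dagger>))\<^sup>2 / (spectral_norm (B\<^sup>\<dagger>))\<^sup>2)
        ((norm (B ** (B\<^sup>\<dagger> - A\<^sup>\<dagger>) ** A))\<^sup>2 / (spectral_norm A)\<^sup>2)"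
proof -
  let ?F = "(B - A) ** A\<^sup>\<dagger>" and ?Q = "col_proj B"
  \<comment> \<open>The complementary projection of \<open>?Q\<close> annihilates \<open>B\<close>,
    so only the contribution of \<open>- A\<close> to \<open>?F\<close> survives.\<close>
  have "?F - ?Q ** ?F = - (col_proj A - ?Q ** col_proj A)"
    by (simp add: matrix_diff_ldistrib matrix_diff_rdistrib matrix_mul_assoc col_proj_mult_self)
      (simp add: col_proj_def matrix_mul_assoc)
  then have split: "(norm ?F)\<^sup>2 =
      (norm (?Q ** ?F))\<^sup>2 + (norm (col_proj A - ?Q ** col_proj A))\<^sup>2"
    using norm_orthogonal_projection[OF conj_transpose_col_proj col_proj_idem, of ?F B]
    by (metis norm_minus_cancel)
  have "B\<^sup>\<dagger> ** (B - A) ** A\<^sup>\<dagger> = B\<^sup>\<dagger> ** (?Q ** ?F)"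
    by (simp add: matrix_mul_assoc moore_penrose_mult_col_proj)
  then have "norm (B\<^sup>\<dagger> ** (B - A) ** A\<^sup>\<dagger>) \<le> spectral_norm (B\<^sup>\<dagger>) * norm (?Q ** ?F)"
    by (simp add: norm_matrix_mult_le_left)
  then have 1: "(norm (B\<^sup>\<dagger> ** (B - A) ** A\<^sup>\<dagger>))\<^sup>2 / (spectral_norm (B\<^sup>\<dagger>))\<^sup>2 \<le> (norm (?Q ** ?F))\<^sup>2"
    by (intro power2_divide_le_if_le_mult norm_ge_zero)
  have "?Q ** (A ** A\<^sup>\<dagger> ** A) = ?Q ** A"
    by (simp only: mult_moore_penrose_mult)
  then have "?Q ** A ** A\<^sup>\<dagger> ** A = ?Q ** A"
    by (simp only: matrix_mul_assoc)
  \<comment> \<open>Both sides equal \<open>?Q ** A - B ** A\<^sup>\<dagger> ** A\<close>.\<close>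
  then have "B ** (B\<^sup>\<dagger> - A\<^sup>\<dagger>) ** A = - (?Q ** ?F ** A)"
    by (simp add: matrix_diff_ldistrib matrix_diff_rdistrib matrix_mul_assoc col_proj_mult_self
        col_proj_def[of B, symmetric])
  then have "norm (B ** (B\<^sup>\<dagger> - A\<^sup>\<dagger>) ** A) \<le> spectral_norm A * norm (?Q ** ?F)"
    by (simp add: norm_matrix_mult_le_right)
  then have 2: "(norm (B ** (B\<^sup>\<dagger> - A\<^sup>\<dagger>) ** A))\<^sup>2 / (spectral_norm A)\<^sup>2 \<le> (norm (?Q ** ?F))\<^sup>2"
    by (intro power2_divide_le_if_le_mult norm_ge_zero)
  from split 1 2 show ?thesis
    by simp
qed

text \<open>Exchanging \<open>A\<close> and \<open>B\<close> negates both differences; since norms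
  ignore the sign, the bound involving \<alpha>\<open>\<^sub>1\<close> also yields the one involving
  \<alpha>\<open>\<^sub>2\<close>.\<close>

lemma norm_matrix_mult_diff_commute:
  fixes N :: "complex ^ 'n ^ 'm"
  shows "norm ((M - N) ** X) = norm ((N - M) ** X)"
    and "norm (Y ** (M - N) ** X) = norm (Y ** (N - M) ** X)"
  by (simp_all add: matrix_diff_ldistrib matrix_diff_rdistrib norm_minus_commute)

theorem theorem3p2:
  fixes A B E :: "complex ^ 'n ^ 'm"
    and E' :: "complex ^ 'm ^ 'n"
    and r s :: nat
    and \<alpha>\<^sub>1 \<alpha>\<^sub>2 :: real
  assumes "rank A = r" and "r \<ge> 1"
    and "rank B = s" and "s \<ge> 1"
    and "E = B - A"
    and "E' = B\<^sup>\<dagger> - A\<^sup>\<dagger>"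
    and "\<alpha>\<^sub>1 = max ((frobenius_norm (B\<^sup>\<dagger> ** E ** A\<^sup>\<dagger>))\<^sup>2 / (spectral_norm (B\<^sup>\<dagger>))\<^sup>2)
                  ((frobenius_norm (B ** E' ** A))\<^sup>2 / (spectral_norm A)\<^sup>2)"
    and "\<alpha>\<^sub>2 = max ((frobenius_norm (A\<^sup>\<dagger> ** E ** B\<^sup>\<dagger>))\<^sup>2 / (spectral_norm (A\<^sup>\<dagger>))\<^sup>2)
                  ((frobenius_norm (A ** E' ** B))\<^sup>2 / (spectral_norm B)\<^sup>2)"
  shows "(frobenius_norm (col_proj B - col_proj A))\<^sup>2
           \<le> (frobenius_norm (E ** A\<^sup>\<dagger>))\<^sup>2 + (frobenius_norm (E ** B\<^sup>\<dagger>))\<^sup>2 - \<alpha>\<^sub>1 - \<alpha>\<^sub>2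
       \<and> (s = r \<longrightarrow>
           (frobenius_norm (col_proj B - col_proj A))\<^sup>2
           \<le> 2 * min ((frobenius_norm (E ** A\<^sup>\<dagger>))\<^sup>2 - \<alpha>\<^sub>1)
                     ((frobenius_norm (E ** B\<^sup>\<dagger>))\<^sup>2 - \<alpha>\<^sub>2))"
proof -
  have A: "(norm (col_proj A - col_proj B ** col_proj A))\<^sup>2 \<le> (norm (E ** A\<^sup>\<dagger>))\<^sup>2 - \<alpha>\<^sub>1"
    using norm_col_proj_residual_le[of A B] assms by (simp add: frobenius_norm_eq_norm)
  have B: "(norm (col_proj B - col_proj A ** col_proj B))\<^sup>2 \<le> (norm (E ** B\<^sup>\<dagger>))\<^sup>2 - \<alpha>\<^sub>2"
    using norm_col_proj_residual_le[of B A] assms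
    by (simp add: frobenius_norm_eq_norm norm_matrix_mult_diff_commute(1)[of A B]
        norm_matrix_mult_diff_commute(2)[of _ A B]
        norm_matrix_mult_diff_commute(2)[of _ "A\<^sup>\<dagger>" "B\<^sup>\<dagger>"])
  \<comment> \<open>For equal ranks the sum of the two squared residuals is twice either of them, so
    each of the bounds A and B applies alone and the minimum results.\<close>
  have "norm (col_proj A - col_proj B ** col_proj A) =
        norm (col_proj B - col_proj A ** col_proj B)" if "s = r"
    using that assms by (intro norm_col_proj_residual_commute) simp
  with A B norm_col_proj_diff[of B A] show ?thesis
    by (auto simp: frobenius_norm_eq_norm)
qed

end
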